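(* Let $n\ge 4$ and let $G$ be a signed multigraph on $[n]$ with degrees $d_1,\dots,d_n$, $e=\frac12\sum_{i,j}G_{ij}$, index of primitivity $k$, and let $f=(f_1,\dots,f_n)$ be a potential vector for $G$. Let $\Lambda^*_G\subseteq\mathbb{Z}^3$ be the $\mathbb{Z}$-module generated by the vectors $(1,d_i,2f_i)$, $i=1,\dots,n$, together with $(0,0,k)$. Let $b$ be the least positive integer such that $b\,\big(1,\tfrac{2e}{n},\tfrac{2e}{n(n-1)}\big)\in\Lambda^*_G$. Then $\operatorname{bal}(G)=b$.
   Context: A signed multigraph on $[n]$ is a symmetric matrix $G\in\mathbb{Z}^{n\times n}$ with zero diagonal ($G_{ij}$ is the, possibly negative, multiplicity of edge $\{i,j\}$); its degrees are $d_i=\sum_j G_{ij}$. For a permutation $\sigma$ of $[n]$, $G^\sigma$ is given by $(G^\sigma)_{ij}=G_{\sigma(i)\sigma(j)}$. $\operatorname{bal}(G)$ is the least positive integer of the form $\sum_{\sigma\in S_n}c_\sigma$ with $c_\sigma\in\mathbb{Z}$ and $\sum_\sigma c_\sigma G^\sigma\in\{aI+bJ:a,b\in\mathbb{Z}\}$ ($I$ identity, $J$ all-ones). The index of primitivity of $G$ is $k=\gcd\{(G^\pi)_{13}-(G^\pi)_{23}-(G^\pi)_{14}+(G^\pi)_{24}:\pi\in S_n\}\ge 0$. A potential vector for $G$ is a vector $f\in(\tfrac12\mathbb{Z})^n$ whose entries are either all integers or all in $\tfrac12\mathbb{Z}\setminus\mathbb{Z}$, such that $G_{ij}-f_i-f_j\in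 k\mathbb{Z}$ for all $i\ne j$ (meaning $G_{ij}=f_i+f_j$ when $k=0$). *)

theory Defs
  imports "HOL-Analysis.Analysis" "HOL-Combinatorics.Permutations"
begin

text \<open>
  An integer \<open>n \<times> n\<close> matrix is a function \<open>G :: nat \<Rightarrow> nat \<Rightarrow> int\<close> of which only the entries with
  indices in \<open>{1..n}\<close> matter; \<open>\<sigma> permutes {1..n}\<close> plays the role of \<open>\<sigma> \<in> S\<^sub>n\<close>.
\<close>

definition signed_multigraph :: "nat \<Rightarrow> (nat \<Rightarrow> nat \<Rightarrow> int) \<Rightarrow> bool" where
  "signed_multigraph n G \<longleftrightarrow>
     (\<forall>i\<in>{1..n}. \<forall>j\<in>{1..n}. G i j = G j i) \<and> (\<forall>i\<in>{1..n}. G i i = 0)"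

definition degree :: "nat \<Rightarrow> (nat \<Rightarrow> nat \<Rightarrow> int) \<Rightarrow> nat \<Rightarrow> int" where
  "degree n G i = (\<Sum>j\<in>{1..n}. G i j)"

definition num_edges :: "nat \<Rightarrow> (nat \<Rightarrow> nat \<Rightarrow> int) \<Rightarrow> rat" where
  "num_edges n G = (\<Sum>i\<in>{1..n}. \<Sum>j\<in>{1..n}. of_int (G i j)) / 2"

definition relabel :: "(nat \<Rightarrow> nat) \<Rightarrow> (nat \<Rightarrow> nat \<Rightarrow> int) \<Rightarrow> nat \<Rightarrow> nat \<Rightarrow> int" where
  "relabel \<sigma> G i j = G (\<sigma> i) (\<sigma> j)"

text \<open>Membership in \<open>{aI + bJ | a b}\<close>, read entrywise.\<close>

definition in_span_I_J :: "nat \<Rightarrow> (nat \<Rightarrow> nat \<Rightarrow> int) \<Rightarrow> bool" where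
  "in_span_I_J n M \<longleftrightarrow>
     (\<exists>a b :: int. \<forall>i\<in>{1..n}. \<forall>j\<in>{1..n}. M i j = a * (if i = j then 1 else 0) + b * 1)"

text \<open>
  For a signed multigraph the minimum is over a nonempty set: \<open>c\<^sub>\<sigma> = 1\<close> for all \<open>\<sigma>\<close> is admissible.
\<close>

definition bal :: "nat \<Rightarrow> (nat \<Rightarrow> nat \<Rightarrow> int) \<Rightarrow> nat" where
  "bal n G = (LEAST m. 0 < m \<and>
     (\<exists>c :: (nat \<Rightarrow> nat) \<Rightarrow> int.
        int m = (\<Sum>\<sigma> | \<sigma> permutes {1..n}. c \<sigma>) \<and>
        in_span_I_J n (\<lambda>i j. \<Sum>\<sigma> | \<sigma> permutes {1..n}. c \<sigma> * relabel \<sigma> G i j)))"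

text \<open>On \<open>int\<close>, \<open>Gcd\<close> is the nonnegative generator of the ideal generated by the set.\<close>

definition primitivity_index :: "nat \<Rightarrow> (nat \<Rightarrow> nat \<Rightarrow> int) \<Rightarrow> int" where
  "primitivity_index n G =
     Gcd {relabel \<pi> G 1 3 - relabel \<pi> G 2 3 - relabel \<pi> G 1 4 + relabel \<pi> G 2 4 | \<pi>.
            \<pi> permutes {1..n}}"

definition potential_vector :: "nat \<Rightarrow> (nat \<Rightarrow> nat \<Rightarrow> int) \<Rightarrow> (nat \<Rightarrow> rat) \<Rightarrow> bool" where
  "potential_vector n G f \<longleftrightarrow>
     ((\<forall>i\<in>{1..n}. f i \<in> \<int>) \<or> (\<forall>i\<in>{1..n}. 2 * f i \<in> \<int> \<and> f i \<notin> \<int>)) \<and>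
     (\<forall>i\<in>{1..n}. \<forall>j\<in>{1..n}. i \<noteq> j \<longrightarrow>
        (\<exists>m :: int. of_int (G i j) - f i - f j = of_int (primitivity_index n G) * of_int m))"

text \<open>
  The lattice is realised inside \<open>rat ^ 3\<close>, since the vector it is compared with is rational.
  All its generators have integer coordinates when \<open>f\<close> is a potential vector.
\<close>

definition int_scale :: "int \<Rightarrow> rat ^ 3 \<Rightarrow> rat ^ 3" where
  "int_scale m v = of_int m *s v"

lemma module_int_scale: "module int_scale"
  by unfold_locales (simp_all add: int_scale_def vec_eq_iff algebra_simps)

definition Lambda_star :: "nat \<Rightarrow> (nat \<Rightarrow> nat \<Rightarrow> int) \<Rightarrow> (nat \<Rightarrow> rat) \<Rightarrow> (rat ^ 3) set" where
  "Lambda_star n G f = module.span int_scale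
     ((\<lambda>i. vector [1, of_int (degree n G i), 2 * f i]) ` {1..n}
        \<union> {vector [0, 0, of_int (primitivity_index n G)]})"

definition mean_vector :: "nat \<Rightarrow> (nat \<Rightarrow> nat \<Rightarrow> int) \<Rightarrow> rat ^ 3" where
  "mean_vector n G =
     vector [1, 2 * num_edges n G / of_nat n, 2 * num_edges n G / (of_nat n * (of_nat n - 1))]"

end

theory Submission imports Defs begin

text \<open>
  If \<open>\<Sum>\<^sub>\<sigma> c\<^sub>\<sigma> G\<^sup>\<sigma>\<close> is constant off the diagonal, its first row and the entries 12, 13, 23 show that
  \<open>\<Sum>\<^sub>\<sigma> c\<^sub>\<sigma> (1, d, 2f)\<close>, taken at \<open>\<sigma>(1)\<close>, is the multiple of the mean vector modulo \<open>(0, 0, k)\<close>.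
  Conversely, coefficients \<open>a\<^sub>i\<close> witnessing membership in \<open>\<Lambda>\<^sup>*\<close> lift to a combination of permutation
  matrices whose first \<open>n - 1\<close> rows equal \<open>a\<close>. The corresponding combination of the \<open>G\<^sup>\<sigma>\<close> has constant
  degrees and off-diagonal entries constant modulo \<open>k\<close>, so it differs from a multiple of \<open>J - I\<close>
  by \<open>k\<close> times a matrix with zero row sums. Such a matrix is a combination of alternating 4-cycles,
  and \<open>k\<close> times an alternating 4-cycle is an integer combination of second differences of the \<open>G\<^sup>\<sigma>\<close>
  along two disjoint transpositions, whose coefficients sum to zero.
\<close>

section \<open>Integer combinations of relabelings\<close>

abbreviation "swap \<equiv> Transposition.transpose"

text \<open>The coefficient sum \<open>m\<close> is carried along with the matrix because
  \<open>bal\<close> is the least positive such sum; corrections with \<open>m = 0\<close> can then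
  be added freely. \<open>M\<close> is constrained only on \<open>{1..n}\<close>, so any convenient
  formula may describe it.\<close>

definition relabel_comb :: "nat \<Rightarrow> (nat \<Rightarrow> nat \<Rightarrow> int) \<Rightarrow> int \<Rightarrow> (nat \<Rightarrow> nat \<Rightarrow> int) \<Rightarrow> bool" where
  "relabel_comb n G m M \<longleftrightarrow>
     (\<exists>c :: (nat \<Rightarrow> nat) \<Rightarrow> int. m = (\<Sum>\<sigma> | \<sigma> permutes {1..n}. c \<sigma>) \<and>
        (\<forall>i\<in>{1..n}. \<forall>j\<in>{1..n}. M i j = (\<Sum>\<sigma> | \<sigma> permutes {1..n}. c \<sigma> * relabel \<sigma> G i j)))"

lemma relabel_combE:
  assumes "relabel_comb n G m M"
  obtains c :: "(nat \<Rightarrow> nat) \<Rightarrow> int" where "m = (\<Sum>\<sigma> | \<sigma> permutes {1..n}. c \<sigma>)"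
    "\<And>i j. i \<in> {1..n} \<Longrightarrow> j \<in> {1..n} \<Longrightarrow>
      (\<Sum>\<sigma> | \<sigma> permutes {1..n}. c \<sigma> * relabel \<sigma> G i j) = M i j"
proof -
  obtain c where c: "m = (\<Sum>\<sigma> | \<sigma> permutes {1..n}. c \<sigma>)"
    "\<forall>i\<in>{1..n}. \<forall>j\<in>{1..n}. M i j = (\<Sum>\<sigma> | \<sigma> permutes {1..n}. c \<sigma> * relabel \<sigma> G i j)"
    using assms unfolding relabel_comb_def by blast
  show ?thesis by (rule that[OF c(1)]) (use c(2) in simp)
qed

lemma relabel_comb_cong:
  assumes "relabel_comb n G m M" "\<And>i j. i \<in> {1..n} \<Longrightarrow> j \<in> {1..n} \<Longrightarrow> M i j = N i j"
  shows "relabel_comb n G m N"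
  using assms unfolding relabel_comb_def by metis

lemma relabel_comb_zero: "relabel_comb n G 0 (\<lambda>_ _. 0)"
  unfolding relabel_comb_def by (rule exI[of _ "\<lambda>_. 0"]) simp

lemma relabel_comb_relabel:
  assumes "\<sigma> permutes {1..n}"
  shows "relabel_comb n G 1 (relabel \<sigma> G)"
proof -
  have fin: "finite {\<sigma>. \<sigma> permutes {1..n}}" by (simp add: finite_permutations)
  show ?thesis
    unfolding relabel_comb_def
    by (rule exI[of _ "\<lambda>\<tau>. of_bool (\<tau> = \<sigma>)"])
       (use assms fin in \<open>simp add: of_bool_def if_distrib[of "\<lambda>x. x * _"] cong: if_cong\<close>)
qed

lemma relabel_comb_add:
  assumes "relabel_comb n G m M" "relabel_comb n G l N"
  shows "relabel_comb n G (m + l) (\<lambda>i j. M i j + N i j)"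
proof -
  obtain c where c: "m = (\<Sum>\<sigma> | \<sigma> permutes {1..n}. c \<sigma>)"
    "\<And>i j. i \<in> {1..n} \<Longrightarrow> j \<in> {1..n} \<Longrightarrow>
      (\<Sum>\<sigma> | \<sigma> permutes {1..n}. c \<sigma> * relabel \<sigma> G i j) = M i j"
    using relabel_combE[OF assms(1)] by blast
  obtain d where d: "l = (\<Sum>\<sigma> | \<sigma> permutes {1..n}. d \<sigma>)"
    "\<And>i j. i \<in> {1..n} \<Longrightarrow> j \<in> {1..n} \<Longrightarrow>
      (\<Sum>\<sigma> | \<sigma> permutes {1..n}. d \<sigma> * relabel \<sigma> G i j) = N i j"
    using relabel_combE[OF assms(2)] by blast
  show ?thesis
    unfolding relabel_comb_def
    by (rule exI[of _ "\<lambda>\<sigma>. c \<sigma> + d \<sigma>"]) (simp add: c(1) d(1) sum.distrib distrib_right flip: c(2) d(2))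
qed

lemma relabel_comb_scale:
  assumes "relabel_comb n G m M"
  shows "relabel_comb n G (t * m) (\<lambda>i j. t * M i j)"
proof -
  obtain c where c: "m = (\<Sum>\<sigma> | \<sigma> permutes {1..n}. c \<sigma>)"
    "\<And>i j. i \<in> {1..n} \<Longrightarrow> j \<in> {1..n} \<Longrightarrow>
      (\<Sum>\<sigma> | \<sigma> permutes {1..n}. c \<sigma> * relabel \<sigma> G i j) = M i j"
    using relabel_combE[OF assms] by blast
  show ?thesis
    unfolding relabel_comb_def
    by (rule exI[of _ "\<lambda>\<sigma>. t * c \<sigma>"]) (simp add: c(1) sum_distrib_left mult.assoc flip: c(2))
qed

lemma relabel_comb_diff:
  assumes "relabel_comb n G m M" "relabel_comb n G l N"
  shows "relabel_comb n G (m - l) (\<lambda>i j. M i j - N i j)"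
  using relabel_comb_add[OF assms(1) relabel_comb_scale[OF assms(2), of "-1"]] by simp

section \<open>Extending partial injections, and gcds as members of ideals\<close>

text \<open>A permutation that is right on the tail is corrected at the new point by swapping
  \<open>\<rho> x\<close> and \<open>y\<close>. Injectivity and distinctness keep both of these away
  from the images of the tail, so earlier values survive.\<close>

lemma permutes_extending:
  assumes "length xs = length ys" "distinct xs" "distinct ys" "set xs \<subseteq> S" "set ys \<subseteq> S"
  shows "\<exists>\<rho>. \<rho> permutes S \<and> map \<rho> xs = ys"
  using assms
proof (induction xs ys rule: list_induct2)
  case Nil
  then show ?case using permutes_id[of S] by (auto intro: exI[of _ id])
next
  case (Cons x xs y ys)
  then obtain \<rho> where \<rho>: "\<rho> permutes S" "map \<rho> xs = ys" by auto
  have 1: "swap (\<rho> x) y permutes S"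
    using Cons.prems \<rho>(1) by (intro permutes_swap_id) (auto simp: permutes_in_image)
  have "(swap (\<rho> x) y \<circ> \<rho>) z = \<rho> z" if "z \<in> set xs" for z
  proof -
    have "\<rho> z \<noteq> \<rho> x" using that Cons.prems permutes_inj[OF \<rho>(1)] by (auto dest: injD)
    moreover have "\<rho> z \<noteq> y" using that Cons.prems \<rho>(2) by auto
    ultimately show ?thesis by (simp add: Transposition.transpose_def)
  qed
  then have "map (swap (\<rho> x) y \<circ> \<rho>) xs = ys" using \<rho>(2) by (auto intro: map_cong)
  moreover have "(swap (\<rho> x) y \<circ> \<rho>) permutes S" by (rule permutes_compose[OF \<rho>(1) 1])
  moreover have "(swap (\<rho> x) y \<circ> \<rho>) x = y" by simp
  ultimately have "(swap (\<rho> x) y \<circ> \<rho>) permutes S \<and> map (swap (\<rho> x) y \<circ> \<rho>) (x # xs) = y # ys"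
    by (simp del: comp_apply)
  then show ?case by (rule exI[where x = "swap (\<rho> x) y \<circ> \<rho>"])
qed

text \<open>\<open>P\<close> describes an ideal, and Bezout's identity adds one element of
  \<open>A\<close> at a time. It will be used with \<open>P t\<close> saying that \<open>t\<close>
  times an alternating cycle is a combination with coefficient sum 0.\<close>

lemma Gcd_int_in_ideal:
  fixes A :: "int set"
  assumes "finite A" "P 0" "\<And>a. a \<in> A \<Longrightarrow> P a"
    and "\<And>x y. P x \<Longrightarrow> P y \<Longrightarrow> P (x + y)" "\<And>t x. P x \<Longrightarrow> P (t * x)"
  shows "P (Gcd A)"
  using assms(1,3)
proof (induction A rule: finite_induct)
  case empty
  then show ?case using assms(2) by simp
next
  case (insert a A)
  obtain u v where "u * a + v * Gcd A = gcd a (Gcd A)" using bezout_int by blast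
  moreover have "P (u * a + v * Gcd A)" using insert by (intro assms(4) assms(5)) auto
  ultimately show ?case by simp
qed

section \<open>Alternating 4-cycles\<close>

text \<open>For distinct vertices this is the signed adjacency matrix of the 4-cycle a, c, b, d: +1
  on ac and bd, -1 on bc and ad. It is written as the symmetrised product of two differences of unit
  vectors, which makes symmetry and zero row sums immediate.\<close>

definition alt_cycle :: "nat \<Rightarrow> nat \<Rightarrow> nat \<Rightarrow> nat \<Rightarrow> nat \<Rightarrow> nat \<Rightarrow> int" where
  "alt_cycle a b c d i j =
     (of_bool (i = a) - of_bool (i = b)) * (of_bool (j = c) - of_bool (j = d)) +
     (of_bool (j = a) - of_bool (j = b)) * (of_bool (i = c) - of_bool (i = d))"

lemma alt_cycle_sym: "alt_cycle a b c d i j = alt_cycle a b c d j i"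
  by (simp add: alt_cycle_def algebra_simps)

lemma alt_cycle_row_sum:
  assumes "finite S" "{a, b, c, d} \<subseteq> S"
  shows "(\<Sum>j\<in>S. alt_cycle a b c d i j) = 0"
proof -
  have "(\<Sum>j\<in>S. (of_bool (j = u) - of_bool (j = v) :: int)) = 0" if "u \<in> S" "v \<in> S" for u v
    using that assms(1) by (simp add: sum_subtractf of_bool_def)
  then show ?thesis
    using assms by (simp add: alt_cycle_def sum.distrib flip: sum_distrib_left sum_distrib_right)
qed

text \<open>The left side is a second difference along two disjoint transpositions. Up to symmetry,
  an entry not joining \<open>{a, b}\<close> to \<open>{c, d}\<close> is fixed by one of the two
  swaps and cancels; the four joining entries give the same number up to sign.\<close>

lemma relabel_alternating_sum:
  fixes H :: "nat \<Rightarrow> nat \<Rightarrow> int"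
  assumes "\<And>i j. i \<in> S \<Longrightarrow> j \<in> S \<Longrightarrow> H i j = H j i" "\<And>i. i \<in> S \<Longrightarrow> H i i = 0"
    and d: "distinct [a, b, c, d]" and S: "a \<in> S" "b \<in> S" "c \<in> S" "d \<in> S" "i \<in> S" "j \<in> S"
  shows "(H i j - relabel (swap a b) H i j) -
      (relabel (swap c d) H i j - relabel (swap a b \<circ> swap c d) H i j) =
    (H a c - H b c - H a d + H b d) * alt_cycle a b c d i j"
proof -
  have i: "i = a \<or> i = b \<or> i = c \<or> i = d \<or> i \<notin> {a,b,c,d}" by auto
  have j: "j = a \<or> j = b \<or> j = c \<or> j = d \<or> j \<notin> {a,b,c,d}" by auto
  have sym: "H b a = H a b" "H c a = H a c" "H d a = H a d" "H c b = H b c" "H d b = H b d"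
    "H d c = H c d" "H i a = H a i" "H i b = H b i" "H i c = H c i" "H i d = H d i"
    "H j a = H a j" "H j b = H b j" "H j c = H c j" "H j d = H d j"
    "H a a = 0" "H b b = 0" "H c c = 0" "H d d = 0"
    using assms by blast+
  have neq: "a \<noteq> b" "a \<noteq> c" "a \<noteq> d" "b \<noteq> c" "b \<noteq> d" "c \<noteq> d"
    "b \<noteq> a" "c \<noteq> a" "d \<noteq> a" "c \<noteq> b" "d \<noteq> b" "d \<noteq> c"
    using d by auto
  note simps = relabel_def alt_cycle_def Transposition.transpose_def sym neq
  from i show ?thesis
  proof (elim disjE)
    assume [simp]: "i = a"
    from j show ?thesis by (elim disjE) (simp_all add: simps)
  next
    assume [simp]: "i = b"
    from j show ?thesis by (elim disjE) (simp_all add: simps)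
  next
    assume [simp]: "i = c"
    from j show ?thesis by (elim disjE) (simp_all add: simps)
  next
    assume [simp]: "i = d"
    from j show ?thesis by (elim disjE) (simp_all add: simps)
  next
    assume "i \<notin> {a, b, c, d}"
    then have [simp]: "i \<noteq> a" "i \<noteq> b" "i \<noteq> c" "i \<noteq> d" by auto
    from j show ?thesis by (elim disjE) (simp_all add: simps)
  qed
qed

text \<open>The index is a gcd, so by \<open>Gcd_int_in_ideal\<close> it suffices to realise each
  single value \<open>?q \<pi>\<close> as a factor of the cycle.\<close>

lemma relabel_comb_alt_cycle:
  assumes G: "signed_multigraph n G" and d: "distinct [a, b, c, d]"
    and S: "{a, b, c, d} \<subseteq> {1..n}" and n: "n \<ge> 4"
  shows "relabel_comb n G 0 (\<lambda>i j. primitivity_index n G * alt_cycle a b c d i j)"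
proof -
  let ?q = "\<lambda>\<pi>. relabel \<pi> G 1 3 - relabel \<pi> G 2 3 - relabel \<pi> G 1 4 + relabel \<pi> G 2 4"
  let ?P = "\<lambda>t. relabel_comb n G 0 (\<lambda>i j. t * alt_cycle a b c d i j)"
  have q: "?P (?q \<pi>)" if \<pi>: "\<pi> permutes {1..n}" for \<pi>
  proof -
    \<comment> \<open>Precomposing \<open>\<pi>\<close> with \<open>\<rho>\<close> moves the
      expression at 1, 2, 3, 4 defining the index to the given vertices a, b, c, d.\<close>
    obtain \<rho> where \<rho>: "\<rho> permutes {1..n}" "map \<rho> [a, b, c, d] = [1, 2, 3, 4]"
      using permutes_extending[of "[a,b,c,d]" "[1,2,3,4]" "{1..n}"] d S n by auto
    define \<sigma> where "\<sigma> = \<pi> \<circ> \<rho>"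
    have \<sigma>: "\<sigma> permutes {1..n}" unfolding \<sigma>_def by (rule permutes_compose[OF \<rho>(1) \<pi>])
    let ?H = "relabel \<sigma> G"
    have t: "swap a b permutes {1..n}" "swap c d permutes {1..n}"
      using S by (auto intro: permutes_swap_id)
    have H: "?H i j = ?H j i" "?H i i = 0" if "i \<in> {1..n}" "j \<in> {1..n}" for i j
      using G permutes_in_image[OF \<sigma>] that unfolding signed_multigraph_def relabel_def by blast+
    \<comment> \<open>The coefficient sum is left unevaluated to mirror the nested differences of
      four relabelings.\<close>
    have "relabel_comb n G ((1 - 1) - (1 - 1)) (\<lambda>i j.
        (relabel \<sigma> G i j - relabel (\<sigma> \<circ> swap a b) G i j) -
        (relabel (\<sigma> \<circ> swap c d) G i j - relabel (\<sigma> \<circ> (swap a b \<circ> swap c d)) G i j))"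
      by (intro relabel_comb_diff relabel_comb_relabel permutes_compose \<sigma> t)
    moreover have "relabel (\<sigma> \<circ> \<tau>) G = relabel \<tau> ?H" for \<tau>
      by (intro ext) (simp add: relabel_def)
    ultimately have "relabel_comb n G 0 (\<lambda>i j.
        (?H i j - relabel (swap a b) ?H i j) -
        (relabel (swap c d) ?H i j - relabel (swap a b \<circ> swap c d) ?H i j))"
      by simp
    then have "?P (?H a c - ?H b c - ?H a d + ?H b d)"
      by (rule relabel_comb_cong)
         (rule relabel_alternating_sum[where S="{1..n}"], use H d S in auto)
    moreover have "?H a c - ?H b c - ?H a d + ?H b d = ?q \<pi>"
      using \<rho>(2) by (simp add: relabel_def \<sigma>_def)
    ultimately show ?thesis by simp
  qed
  have eq: "{?q \<pi> | \<pi>. \<pi> permutes {1..n}} = ?q ` {\<pi>. \<pi> permutes {1..n}}" by auto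
  show ?thesis
    unfolding primitivity_index_def eq
  proof (rule Gcd_int_in_ideal[where P = ?P])
    show "?P 0" by (simp add: relabel_comb_zero)
    show "?P (x + y)" if "?P x" "?P y" for x y
      using relabel_comb_add[OF that] by (simp add: distrib_right)
    show "?P (t * x)" if "?P x" for t x
      using relabel_comb_scale[OF that, of t] by (simp add: mult.assoc)
  qed (use q in \<open>auto simp: finite_permutations\<close>)
qed

section \<open>Symmetric matrices with zero row sums\<close>

text \<open>On three vertices the three row equations say that any two of the entries 12, 13, 23 sum
  to 0, so all vanish. Smaller \<open>m\<close> is padded to 3 by zeros.\<close>

lemma zero_row_sums_small:
  fixes y :: "nat \<Rightarrow> nat \<Rightarrow> int"
  assumes "m \<le> 3" "\<And>i j. y i j = y j i" "\<And>i. y i i = 0" "\<And>i j. i \<notin> {1..m} \<Longrightarrow> y i j = 0"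
    and "\<And>i. (\<Sum>j\<in>{1..m}. y i j) = 0"
  shows "y = (\<lambda>_ _. 0)"
proof -
  have out: "y i j = 0" if "i \<notin> {1..m} \<or> j \<notin> {1..m}" for i j
    using that assms(2,4) by metis
  have "(\<Sum>j\<in>{1..3}. y i j) = 0" for i
    unfolding assms(5)[of i, symmetric]
    by (rule sum.mono_neutral_right) (use assms(1) out in auto)
  then have "y i 1 + y i 2 + y i 3 = 0" for i by (simp add: numeral_3_eq_3 numeral_2_eq_2 add.assoc)
  from this[of 1] this[of 2] this[of 3] have 0: "y 1 2 = 0" "y 1 3 = 0" "y 2 3 = 0"
    using assms(2)[of 2 1] assms(2)[of 3 1] assms(2)[of 3 2] assms(3)[of 1] assms(3)[of 2] assms(3)[of 3]
    by linarith+
  have "y i j = 0" for i j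
  proof (cases "i \<in> {1..3} \<and> j \<in> {1..3}")
    case True
    then have "i = 1 \<or> i = 2 \<or> i = 3" "j = 1 \<or> j = 2 \<or> j = 3" by auto
    then show ?thesis using 0 assms(2)[of 2 1] assms(2)[of 3 1] assms(2)[of 3 2] assms(3) by auto
  next
    case False
    then show ?thesis using out assms(1) by (metis atLeastAtMost_iff le_trans)
  qed
  then show ?thesis by (intro ext)
qed

text \<open>
  Alternating 4-cycles through the last vertex clear its row; on three vertices only the zero
  matrix is left.
\<close>

lemma zero_row_sums_induct:
  fixes y :: "nat \<Rightarrow> nat \<Rightarrow> int"
  assumes zero: "P (\<lambda>_ _. 0)"
    and add: "\<And>M N. P M \<Longrightarrow> P N \<Longrightarrow> P (\<lambda>i j. M i j + N i j)"
    and cycle: "\<And>a b c d t. distinct [a, b, c, d] \<Longrightarrow> {a, b, c, d} \<subseteq> {1..m} \<Longrightarrow>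
      P (\<lambda>i j. t * alt_cycle a b c d i j)"
    and "\<And>i j. y i j = y j i" "\<And>i. y i i = 0" "\<And>i j. i \<notin> {1..m} \<Longrightarrow> y i j = 0"
    and "\<And>i. (\<Sum>j\<in>{1..m}. y i j) = 0"
  shows "P y"
  using assms(3-)
proof (induction m arbitrary: y)
  case 0
  then have "y = (\<lambda>_ _. 0)" by (intro zero_row_sums_small[of 0]) auto
  then show ?case using zero by simp
next
  case (Suc m)
  note cycle = Suc.prems(1) and sym = Suc.prems(2) and diag = Suc.prems(3)
    and supp = Suc.prems(4) and row = Suc.prems(5)
  show ?case
  proof (cases "Suc m \<le> 3")
    case True
    then have "y = (\<lambda>_ _. 0)" using sym diag supp row by (intro zero_row_sums_small[of "Suc m"]) auto
    then show ?thesis using zero by simp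
  next
    case False
    \<comment> \<open>The fourth vertex of a cycle through \<open>Suc m\<close>, \<open>c\<close>
      and 1. It must differ from all three; 2 or 3 is available because \<open>Suc m\<close> is at
      least 4 here.\<close>
    define b where "b c = (if c = 2 then 3 else 2 :: nat)" for c :: nat
    \<comment> \<open>Row \<open>Suc m\<close> of \<open>C c\<close> is +1 in column
      \<open>c\<close> and -1 in column 1, so the weights in \<open>W\<close> reproduce the last row
      of \<open>y\<close> in columns 2 to \<open>m\<close>.\<close>
    define C where "C c = alt_cycle (Suc m) (b c) c 1" for c
    have dist: "distinct [Suc m, b c, c, 1]" "{Suc m, b c, c, 1} \<subseteq> {1..Suc m}" if "c \<in> {2..m}" for c
      using that False by (auto simp: b_def)
    define W where "W i j = (\<Sum>c\<in>{2..m}. y (Suc m) c * C c i j)" for i j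
    define z where "z i j = y i j - W i j" for i j
    have PW: "P (\<lambda>i j. \<Sum>c\<in>A. y (Suc m) c * C c i j)" if "finite A" "A \<subseteq> {2..m}" for A
      using that
    proof (induction A rule: finite_induct)
      case empty
      then show ?case by (simp add: zero)
    next
      case (insert c A)
      have "P (\<lambda>i j. y (Suc m) c * C c i j)"
        unfolding C_def by (rule cycle[OF dist]) (use insert in auto)
      then show ?case using insert by (simp add: add)
    qed
    have C_sym: "C c i j = C c j i" for c i j by (simp add: C_def alt_cycle_sym)
    have W_sym: "W i j = W j i" for i j unfolding W_def by (simp add: C_sym[of _ i j])
    have z_sym: "z i j = z j i" for i j by (simp add: z_def sym[of i j] W_sym[of i j])
    have C_diag: "C c i i = 0" if "c \<in> {2..m}" for c i
      using dist(1)[OF that] by (auto simp: C_def alt_cycle_def)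
    have z_diag: "z i i = 0" for i
      by (simp add: z_def W_def diag C_diag)
    have C_supp: "C c i j = 0" if "c \<in> {2..m}" "i \<notin> {1..Suc m}" for c i j
      using dist(2)[OF that(1)] that(2) by (auto simp: C_def alt_cycle_def)
    have C_row: "(\<Sum>j\<in>{1..Suc m}. C c i j) = 0" if "c \<in> {2..m}" for c i
      unfolding C_def by (rule alt_cycle_row_sum) (use dist(2)[OF that] in auto)
    have z_row': "(\<Sum>j\<in>{1..Suc m}. z i j) = 0" for i
    proof -
      have "(\<Sum>j\<in>{1..Suc m}. W i j) = (\<Sum>c\<in>{2..m}. y (Suc m) c * (\<Sum>j\<in>{1..Suc m}. C c i j))"
        unfolding W_def sum_distrib_left by (rule sum.swap)
      also have "\<dots> = 0"
        by (intro sum.neutral ballI) (simp only: C_row mult_zero_right)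
      finally show ?thesis by (simp only: z_def sum_subtractf row diff_self)
    qed
    have C_last: "C c (Suc m) j = of_bool (j = c)" if "c \<in> {2..m}" "j \<noteq> 1" for c j
      using dist(1)[OF that(1)] that by (auto simp: C_def alt_cycle_def)
    have z_last1: "z (Suc m) j = 0" if "j \<noteq> 1" for j
    proof (cases "j \<in> {2..m}")
      case True
      then show ?thesis using that by (simp add: z_def W_def C_last of_bool_def if_distrib cong: if_cong)
    next
      case False
      then have "y (Suc m) j = 0" 
        using that diag[of "Suc m"] supp[of j "Suc m"] sym[of "Suc m" j] by (cases "j = Suc m") auto
      moreover have "W (Suc m) j = 0"
        unfolding W_def using False that by (intro sum.neutral) (auto simp: C_last)
      ultimately show ?thesis by (simp add: z_def)
    qed
    \<comment> \<open>Column 1 is shared by all the cycles and not controlled by the weights, but it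
      is the only entry left in a row with sum 0.\<close>
    have "z (Suc m) 1 = 0"
    proof -
      have "(\<Sum>j\<in>{1..Suc m}. z (Suc m) j) = (\<Sum>j\<in>{1}. z (Suc m) j)"
        by (rule sum.mono_neutral_right) (use z_last1 in auto)
      then show ?thesis using z_row' by simp
    qed
    with z_last1 have z_last: "z (Suc m) j = 0" for j by (cases "j = 1") auto
    have z_supp: "z i j = 0" if "i \<notin> {1..m}" for i j
    proof (cases "i = Suc m")
      case True
      then show ?thesis using z_last by simp
    next
      case False
      then have "i \<notin> {1..Suc m}" using that by auto
      then show ?thesis using supp[of i j] C_supp by (simp add: z_def W_def)
    qed
    have z_row: "(\<Sum>j\<in>{1..m}. z i j) = 0" for i
      using z_row'[of i] z_last z_sym[of i "Suc m"] by simp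
    have "P z"
    proof (rule Suc.IH)
      show "P (\<lambda>i j. t * alt_cycle a b c d i j)"
        if "distinct [a, b, c, d]" "{a, b, c, d} \<subseteq> {1..m}" for a b c d t
        using cycle[OF that(1)] that(2) by force
    qed (use z_sym z_diag z_supp z_row in auto)
    from add[OF this PW[of "{2..m}"]] show ?thesis
      by (simp add: z_def W_def)
  qed
qed

section \<open>Permutation combinations with prescribed rows\<close>

text \<open>
  \<open>\<Sum>\<^sub>\<sigma> c\<^sub>\<sigma> g(\<sigma> p)\<close> is the pairing of \<open>g\<close> with row \<open>p\<close> of the matrix \<open>\<Sum>\<^sub>\<sigma> c\<^sub>\<sigma> P\<^sub>\<sigma>\<close>. All line sums of that
  matrix agree, so once the first \<open>n - 1\<close> rows are prescribed to be equal, the last one is forced.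
\<close>

lemma constant_row_comb_single:
  assumes i: "i \<in> {1..n}"
  shows "\<exists>c :: (nat \<Rightarrow> nat) \<Rightarrow> int. \<forall>p\<in>{1..n}. \<forall>g :: nat \<Rightarrow> rat.
    (\<Sum>\<sigma> | \<sigma> permutes {1..n}. of_int (c \<sigma>) * g (\<sigma> p)) =
      (if p < n then g i else (\<Sum>j\<in>{1..n}. g j) - (of_nat n - 1) * g i)"
proof -
  define P where "P = {\<sigma>. \<sigma> permutes {1..n}}"
  \<comment> \<open>Row \<open>i\<close> is left out: the identity already has the right row
    there.\<close>
  define R where "R = {1..<n} - {i}"
  \<comment> \<open>For \<open>r\<close> in \<open>R\<close>, \<open>\<tau> r\<close> agrees with
    \<open>swap n i\<close> except that it sends \<open>r\<close> to \<open>i\<close> and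
    \<open>n\<close> to \<open>r\<close>, where \<open>swap n i\<close> fixes \<open>r\<close> and
    sends \<open>n\<close> to \<open>i\<close>.\<close>
  define \<tau> where "\<tau> r = swap n i \<circ> swap r n" for r
  \<comment> \<open>Each difference of \<open>\<tau> r\<close> and \<open>swap n i\<close> turns row
    \<open>r\<close> of the identity into row \<open>i\<close> and puts the compensation into row
    \<open>n\<close>.\<close>
  define c :: "(nat \<Rightarrow> nat) \<Rightarrow> int" where
    "c \<sigma> = of_bool (\<sigma> = id) + (\<Sum>r\<in>R. of_bool (\<sigma> = \<tau> r) - of_bool (\<sigma> = swap n i))" for \<sigma>
  have fin: "finite P" by (simp add: P_def finite_permutations)
  have mem: "id \<in> P" "swap n i \<in> P" "\<And>r. r \<in> R \<Longrightarrow> \<tau> r \<in> P"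
    using i by (auto simp: P_def R_def \<tau>_def permutes_id intro!: permutes_swap_id permutes_compose)
  have delta: "(\<Sum>\<sigma>\<in>P. of_bool (\<sigma> = \<rho>) * h \<sigma>) = h \<rho>" if "\<rho> \<in> P" for \<rho> and h :: "(nat \<Rightarrow> nat) \<Rightarrow> rat"
    using that fin by (simp add: of_bool_def if_distrib[of "\<lambda>x. x * _"] cong: if_cong)
  have "(\<Sum>\<sigma>\<in>P. of_int (c \<sigma>) * g (\<sigma> p)) =
      (if p < n then g i else (\<Sum>j\<in>{1..n}. g j) - (of_nat n - 1) * g i)"
    if p: "p \<in> {1..n}" for p and g :: "nat \<Rightarrow> rat"
  proof -
    have "(\<Sum>\<sigma>\<in>P. of_int (c \<sigma>) * g (\<sigma> p)) =
        (\<Sum>\<sigma>\<in>P. of_bool (\<sigma> = id) * g (\<sigma> p)) + (\<Sum>\<sigma>\<in>P. \<Sum>r\<in>R.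
          of_bool (\<sigma> = \<tau> r) * g (\<sigma> p) - of_bool (\<sigma> = swap n i) * g (\<sigma> p))"
      by (simp add: c_def distrib_right left_diff_distrib sum.distrib sum_distrib_right flip: of_bool_def)
    also have "\<dots> = g p + (\<Sum>r\<in>R. g (\<tau> r p) - g (swap n i p))"
      using mem by (subst sum.swap) (simp add: delta sum_subtractf)
    also have "\<dots> = (if p < n then g i else (\<Sum>j\<in>{1..n}. g j) - (of_nat n - 1) * g i)"
    proof (cases "p < n")
      case True
      have "(\<Sum>r\<in>R. g (\<tau> r p) - g (swap n i p)) = (\<Sum>r\<in>R. if r = p then g i - g p else 0)"
        using True by (intro sum.cong) (auto simp: R_def \<tau>_def Transposition.transpose_def)
      also have "\<dots> = (if p = i then 0 else g i - g p)"
        using p True by (simp add: R_def)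
      finally show ?thesis using True by simp
    next
      case False
      with p have [simp]: "p = n" by simp
      have "(\<Sum>r\<in>R. g (\<tau> r p) - g (swap n i p)) = (\<Sum>r\<in>R. g r - g i)"
        by (intro sum.cong) (auto simp: R_def \<tau>_def Transposition.transpose_def)
      \<comment> \<open>The index \<open>i\<close>, if below \<open>n\<close>, may be restored since
        its term is 0.\<close>
      also have "\<dots> = (\<Sum>r\<in>{1..<n}. g r - g i)"
        unfolding R_def by (rule sum.mono_neutral_left) auto
      also have "\<dots> = (\<Sum>r\<in>{1..<n}. g r) - (of_nat n - 1) * g i"
        using i by (simp add: sum_subtractf of_nat_diff)
      also have "(\<Sum>r\<in>{1..<n}. g r) = (\<Sum>r\<in>{1..n}. g r) - g n"
        using i by (simp add: atLeastLessThanSuc_atLeastAtMost[symmetric])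
      finally show ?thesis by simp
    qed
    finally show ?thesis .
  qed
  then show ?thesis unfolding P_def by blast
qed

text \<open>Superposition of the single-index combinations with weights \<open>a i\<close>. The
  coefficients are chosen before \<open>g\<close>, so one choice serves constants, degrees and
  potentials simultaneously.\<close>

lemma constant_row_comb:
  fixes a :: "nat \<Rightarrow> int"
  shows "\<exists>c :: (nat \<Rightarrow> nat) \<Rightarrow> int. \<forall>p\<in>{1..n}. \<forall>g :: nat \<Rightarrow> rat.
    (\<Sum>\<sigma> | \<sigma> permutes {1..n}. of_int (c \<sigma>) * g (\<sigma> p)) =
      (if p < n then \<Sum>i\<in>{1..n}. of_int (a i) * g i
       else of_int (\<Sum>i\<in>{1..n}. a i) * (\<Sum>j\<in>{1..n}. g j) -
         (of_nat n - 1) * (\<Sum>i\<in>{1..n}. of_int (a i) * g i))"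
proof -
  let ?P = "{\<sigma>. \<sigma> permutes {1..n}}"
  have "\<forall>i\<in>{1..n}. \<exists>c :: (nat \<Rightarrow> nat) \<Rightarrow> int. \<forall>p\<in>{1..n}. \<forall>g :: nat \<Rightarrow> rat.
      (\<Sum>\<sigma>\<in>?P. of_int (c \<sigma>) * g (\<sigma> p)) =
        (if p < n then g i else (\<Sum>j\<in>{1..n}. g j) - (of_nat n - 1) * g i)"
    by (intro ballI constant_row_comb_single)
  from bchoice[OF this] obtain c :: "nat \<Rightarrow> (nat \<Rightarrow> nat) \<Rightarrow> int" where
    c: "\<forall>i\<in>{1..n}. \<forall>p\<in>{1..n}. \<forall>g :: nat \<Rightarrow> rat. (\<Sum>\<sigma>\<in>?P. of_int (c i \<sigma>) * g (\<sigma> p)) =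
      (if p < n then g i else (\<Sum>j\<in>{1..n}. g j) - (of_nat n - 1) * g i)"
    by (elim exE)
  show ?thesis
  proof (intro exI[of _ "\<lambda>\<sigma>. \<Sum>i\<in>{1..n}. a i * c i \<sigma>"] ballI allI)
    fix p and g :: "nat \<Rightarrow> rat"
    assume p: "p \<in> {1..n}"
    have expand: "x * (F - N * y) = x * F - N * (x * y)" for x F N y :: rat
      by (simp add: algebra_simps)
    have "(\<Sum>\<sigma>\<in>?P. of_int (\<Sum>i\<in>{1..n}. a i * c i \<sigma>) * g (\<sigma> p)) =
        (\<Sum>\<sigma>\<in>?P. \<Sum>i\<in>{1..n}. of_int (a i) * (of_int (c i \<sigma>) * g (\<sigma> p)))"
      by (simp add: sum_distrib_right mult.assoc)
    also have "\<dots> = (\<Sum>i\<in>{1..n}. of_int (a i) * (\<Sum>\<sigma>\<in>?P. of_int (c i \<sigma>) * g (\<sigma> p)))"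
      by (subst sum.swap) (simp add: sum_distrib_left)
    also have "\<dots> = (\<Sum>i\<in>{1..n}. of_int (a i) *
        (if p < n then g i else (\<Sum>j\<in>{1..n}. g j) - (of_nat n - 1) * g i))"
      by (intro sum.cong refl arg_cong2[where f = "(*)"] c[rule_format] p)
    also have "\<dots> = (if p < n then \<Sum>i\<in>{1..n}. of_int (a i) * g i
       else of_int (\<Sum>i\<in>{1..n}. a i) * (\<Sum>j\<in>{1..n}. g j) -
         (of_nat n - 1) * (\<Sum>i\<in>{1..n}. of_int (a i) * g i))"
      by (simp add: expand sum_subtractf flip: sum_distrib_left sum_distrib_right)
    finally show "(\<Sum>\<sigma>\<in>?P. of_int (\<Sum>i\<in>{1..n}. a i * c i \<sigma>) * g (\<sigma> p)) = \<dots>" .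
  qed
qed

section \<open>Degrees, potentials and lattice coordinates\<close>

lemma degree_relabel:
  assumes "\<sigma> permutes {1..n}"
  shows "degree n (relabel \<sigma> G) i = degree n G (\<sigma> i)"
  unfolding degree_def relabel_def by (rule sum.permute[OF assms, unfolded o_def, symmetric])

lemma sum_degree: "of_int (\<Sum>i\<in>{1..n}. degree n G i) = 2 * num_edges n G"
  by (simp add: degree_def num_edges_def)

text \<open>The right-hand side defines a submodule containing the generators, so minimality of the
  span gives one direction; the other writes \<open>v\<close> directly as a combination of
  generators.\<close>

lemma Lambda_star_iff:
  "v \<in> Lambda_star n G f \<longleftrightarrow> (\<exists>(a :: nat \<Rightarrow> int) (t :: int).
     v $ 1 = (\<Sum>i\<in>{1..n}. of_int (a i)) \<and>
     v $ 2 = (\<Sum>i\<in>{1..n}. of_int (a i) * of_int (degree n G i)) \<and>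
     v $ 3 = (\<Sum>i\<in>{1..n}. of_int (a i) * (2 * f i)) + of_int t * of_int (primitivity_index n G))"
    (is "_ \<longleftrightarrow> ?R v")
proof
  interpret module int_scale by (rule module_int_scale)
  let ?w = "\<lambda>i. vector [1, of_int (degree n G i), 2 * f i] :: rat ^ 3"
  let ?k = "vector [0, 0, of_int (primitivity_index n G)] :: rat ^ 3"
  have sub: "subspace (Collect ?R)"
  proof (rule subspaceI)
    show "0 \<in> Collect ?R"
      by (auto intro!: exI[of _ "\<lambda>_. 0"] exI[of _ 0])
  next
    fix x y assume "x \<in> Collect ?R" "y \<in> Collect ?R"
    then obtain a t b u where
      "x $ 1 = (\<Sum>i\<in>{1..n}. of_int (a i))"
      "x $ 2 = (\<Sum>i\<in>{1..n}. of_int (a i) * of_int (degree n G i))"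
      "x $ 3 = (\<Sum>i\<in>{1..n}. of_int (a i) * (2 * f i)) + of_int t * of_int (primitivity_index n G)"
      "y $ 1 = (\<Sum>i\<in>{1..n}. of_int (b i))"
      "y $ 2 = (\<Sum>i\<in>{1..n}. of_int (b i) * of_int (degree n G i))"
      "y $ 3 = (\<Sum>i\<in>{1..n}. of_int (b i) * (2 * f i)) + of_int u * of_int (primitivity_index n G)"
      by blast
    then show "x + y \<in> Collect ?R"
      by (auto intro!: exI[of _ "\<lambda>i. a i + b i"] exI[of _ "t + u"] simp: sum.distrib distrib_right)
  next
    fix s x assume "x \<in> Collect ?R"
    then obtain a t where
      "x $ 1 = (\<Sum>i\<in>{1..n}. of_int (a i))"
      "x $ 2 = (\<Sum>i\<in>{1..n}. of_int (a i) * of_int (degree n G i))"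
      "x $ 3 = (\<Sum>i\<in>{1..n}. of_int (a i) * (2 * f i)) + of_int t * of_int (primitivity_index n G)"
      by blast
    then show "int_scale s x \<in> Collect ?R"
      by (auto intro!: exI[of _ "\<lambda>i. s * a i"] exI[of _ "s * t"]
          simp: int_scale_def sum_distrib_left distrib_left mult.assoc)
  qed
  have "?w i \<in> Collect ?R" if "i \<in> {1..n}" for i
    using that by (auto intro!: exI[of _ "\<lambda>j. of_bool (j = i)"] exI[of _ 0]
        simp: of_bool_def if_distrib[of "\<lambda>x. x * _"] if_distrib[of of_int] cong: if_cong)
  moreover have "?k \<in> Collect ?R"
    by (auto intro!: exI[of _ "\<lambda>_. 0"] exI[of _ 1])
  ultimately have "Lambda_star n G f \<subseteq> Collect ?R"
    unfolding Lambda_star_def using sub by (intro span_minimal) auto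
  then show "v \<in> Lambda_star n G f \<Longrightarrow> ?R v" by auto
  show "v \<in> Lambda_star n G f" if "?R v"
  proof -
    from that obtain a t where
      "v $ 1 = (\<Sum>i\<in>{1..n}. of_int (a i))"
      "v $ 2 = (\<Sum>i\<in>{1..n}. of_int (a i) * of_int (degree n G i))"
      "v $ 3 = (\<Sum>i\<in>{1..n}. of_int (a i) * (2 * f i)) + of_int t * of_int (primitivity_index n G)"
      by blast
    then have v: "v = (\<Sum>i\<in>{1..n}. int_scale (a i) (?w i)) + int_scale t ?k"
      by (simp add: vec_eq_iff forall_3 int_scale_def)
    show ?thesis
      unfolding Lambda_star_def v by (intro span_add span_sum span_scale span_base) auto
  qed
qed

text \<open>Congruences modulo the index become exact equations with quotients \<open>e\<close>,
  which can be summed over permutations and also cover index 0.\<close>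

lemma potential_vectorE:
  assumes "potential_vector n G f"
  obtains e :: "nat \<Rightarrow> nat \<Rightarrow> int" where
    "\<And>i j. i \<in> {1..n} \<Longrightarrow> j \<in> {1..n} \<Longrightarrow> i \<noteq> j \<Longrightarrow>
      of_int (G i j) = f i + f j + of_int (primitivity_index n G) * of_int (e i j)"
proof -
  have "\<forall>i j. \<exists>m :: int. i \<in> {1..n} \<longrightarrow> j \<in> {1..n} \<longrightarrow> i \<noteq> j \<longrightarrow>
      of_int (G i j) - f i - f j = of_int (primitivity_index n G) * of_int m"
    using assms unfolding potential_vector_def by blast
  then have "\<forall>i j. \<exists>m :: int. i \<in> {1..n} \<longrightarrow> j \<in> {1..n} \<longrightarrow> i \<noteq> j \<longrightarrow>
      of_int (G i j) = f i + f j + of_int (primitivity_index n G) * of_int m"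
    by (simp add: algebra_simps)
  then show ?thesis using that by metis
qed

text \<open>Row \<open>i\<close> has \<open>n - 1\<close> off-diagonal entries, each contributing
  \<open>f i\<close>; completing the sum of the other potentials to all of \<open>{1..n}\<close>
  costs one more, hence the factor \<open>n - 2\<close>.\<close>

lemma degree_potential:
  assumes "signed_multigraph n G" and i: "i \<in> {1..n}"
    and e: "\<And>i j. i \<in> {1..n} \<Longrightarrow> j \<in> {1..n} \<Longrightarrow> i \<noteq> j \<Longrightarrow>
      of_int (G i j) = f i + f j + of_int k * of_int (e i j)"
  shows "of_int (degree n G i) = (of_nat n - 2) * f i + (\<Sum>j\<in>{1..n}. f j) +
    of_int k * (of_int (\<Sum>j\<in>{1..n} - {i}. e i j) :: rat)"
proof -
  have "(of_int (degree n G i) :: rat) = (\<Sum>j\<in>{1..n}. of_int (G i j))"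
    by (simp add: degree_def)
  also have "\<dots> = (\<Sum>j\<in>{1..n} - {i}. of_int (G i j))"
    using i assms(1) by (subst sum.remove[of _ i]) (auto simp: signed_multigraph_def)
  also have "\<dots> = (\<Sum>j\<in>{1..n} - {i}. f i + f j + of_int k * of_int (e i j))"
    using i e by (intro sum.cong) auto
  also have "\<dots> = (of_nat n - 1) * f i + ((\<Sum>j\<in>{1..n}. f j) - f i) +
      of_int k * of_int (\<Sum>j\<in>{1..n} - {i}. e i j)"
    using i by (simp add: sum.distrib sum_diff1 of_nat_diff flip: sum_distrib_left)
  finally show ?thesis by (simp add: algebra_simps)
qed

text \<open>The multiple \<open>n * (n - 1)\<close> works with all coefficients equal to
  \<open>n - 1\<close>: the second coordinates agree by the handshake identity, the third ones by
  \<open>E\<close>.\<close>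

lemma mean_vector_in_Lambda_star_exists:
  assumes n: "n \<ge> 4" and G: "signed_multigraph n G" and f: "potential_vector n G f"
  shows "\<exists>b :: nat. 0 < b \<and> of_nat b *s mean_vector n G \<in> Lambda_star n G f"
proof -
  let ?k = "primitivity_index n G" and ?F = "\<Sum>j\<in>{1..n}. f j"
  obtain e where e: "\<And>i j. i \<in> {1..n} \<Longrightarrow> j \<in> {1..n} \<Longrightarrow> i \<noteq> j \<Longrightarrow>
      of_int (G i j) = f i + f j + of_int ?k * of_int (e i j)"
    using potential_vectorE[OF f] by metis
  let ?s = "\<Sum>i\<in>{1..n}. \<Sum>j\<in>{1..n} - {i}. e i j"
  have E: "2 * num_edges n G = 2 * (of_nat n - 1) * ?F + of_int ?k * of_int ?s"
  proof -
    have "2 * num_edges n G = (\<Sum>i\<in>{1..n}. of_int (degree n G i))"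
      by (simp flip: sum_degree)
    also have "\<dots> = (\<Sum>i\<in>{1..n}. (of_nat n - 2) * f i + ?F + of_int ?k * of_int (\<Sum>j\<in>{1..n} - {i}. e i j))"
      by (intro sum.cong refl degree_potential[OF G _ e])
    also have "\<dots> = 2 * (of_nat n - 1) * ?F + of_int ?k * of_int ?s"
      by (simp add: sum.distrib flip: sum_distrib_left) (simp add: algebra_simps)
    finally show ?thesis .
  qed
  have "of_nat (n * (n - 1)) *s mean_vector n G \<in> Lambda_star n G f"
    unfolding Lambda_star_iff
  proof (intro exI conjI)
    have nn: "of_nat n \<noteq> (0 :: rat)" "of_nat n - 1 \<noteq> (0 :: rat)"
      using n by auto
    have "rat_of_nat (n - 1) = of_nat n - 1"
      using n by (subst of_nat_diff) auto
    then have c: "(of_nat (n * (n - 1)) :: rat) = of_nat n * (of_nat n - 1)"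
      and a: "rat_of_int (int (n - 1)) = of_nat n - 1"
      by (simp_all only: of_nat_mult of_int_of_nat_eq)
    show "(of_nat (n * (n - 1)) *s mean_vector n G) $ 1 = (\<Sum>i\<in>{1..n}. of_int (int (n - 1)))"
      unfolding a vector_smult_component c by (simp add: mean_vector_def)
    show "(of_nat (n * (n - 1)) *s mean_vector n G) $ 2 =
        (\<Sum>i\<in>{1..n}. of_int (int (n - 1)) * of_int (degree n G i))"
      unfolding sum_distrib_left[symmetric] of_int_sum[symmetric] sum_degree a vector_smult_component c
      using nn by (simp add: mean_vector_def field_simps)
    show "(of_nat (n * (n - 1)) *s mean_vector n G) $ 3 =
        (\<Sum>i\<in>{1..n}. of_int (int (n - 1)) * (2 * f i)) + of_int ?s * of_int ?k"
      unfolding sum_distrib_left[symmetric] a vector_smult_component c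
      using nn E by (simp add: mean_vector_def mult_ac)
  qed
  moreover have "0 < n * (n - 1)" using n by simp
  ultimately show ?thesis by blast
qed

section \<open>Balanced combinations and lattice membership\<close>

text \<open>Relabelings have zero diagonal, which forces the coefficient of the identity matrix to
  be the negative of that of the all-ones matrix.\<close>

lemma balanced_comb_iff:
  assumes G: "signed_multigraph n G"
  shows "(\<exists>c :: (nat \<Rightarrow> nat) \<Rightarrow> int. int m = (\<Sum>\<sigma> | \<sigma> permutes {1..n}. c \<sigma>) \<and>
      in_span_I_J n (\<lambda>i j. \<Sum>\<sigma> | \<sigma> permutes {1..n}. c \<sigma> * relabel \<sigma> G i j)) \<longleftrightarrow>
    (\<exists>l. relabel_comb n G (int m) (\<lambda>i j. if i = j then 0 else l))"
proof
  assume "\<exists>c :: (nat \<Rightarrow> nat) \<Rightarrow> int. int m = (\<Sum>\<sigma> | \<sigma> permutes {1..n}. c \<sigma>) \<and>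
      in_span_I_J n (\<lambda>i j. \<Sum>\<sigma> | \<sigma> permutes {1..n}. c \<sigma> * relabel \<sigma> G i j)"
  then obtain c a b where c: "int m = (\<Sum>\<sigma> | \<sigma> permutes {1..n}. c \<sigma>)"
    and ab: "\<And>i j. i \<in> {1..n} \<Longrightarrow> j \<in> {1..n} \<Longrightarrow>
      (\<Sum>\<sigma> | \<sigma> permutes {1..n}. c \<sigma> * relabel \<sigma> G i j) = a * (if i = j then 1 else 0) + b"
    unfolding in_span_I_J_def by auto
  have "(\<Sum>\<sigma> | \<sigma> permutes {1..n}. c \<sigma> * relabel \<sigma> G i i) = 0" if "i \<in> {1..n}" for i
    using G that unfolding relabel_def signed_multigraph_def
    by (intro sum.neutral ballI) (metis mem_Collect_eq mult_zero_right permutes_in_image)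
  with ab have "(\<Sum>\<sigma> | \<sigma> permutes {1..n}. c \<sigma> * relabel \<sigma> G i j) = (if i = j then 0 else b)"
    if "i \<in> {1..n}" "j \<in> {1..n}" for i j
    using that by (cases "i = j") auto
  with c show "\<exists>l. relabel_comb n G (int m) (\<lambda>i j. if i = j then 0 else l)"
    unfolding relabel_comb_def by (intro exI[of _ b] exI[of _ c] conjI) auto
next
  assume "\<exists>l. relabel_comb n G (int m) (\<lambda>i j. if i = j then 0 else l)"
  then obtain l where l: "relabel_comb n G (int m) (\<lambda>i j. if i = j then 0 else l)" ..
  obtain c where "int m = (\<Sum>\<sigma> | \<sigma> permutes {1..n}. c \<sigma>)"
    "\<And>i j. i \<in> {1..n} \<Longrightarrow> j \<in> {1..n} \<Longrightarrow>
      (\<Sum>\<sigma> | \<sigma> permutes {1..n}. c \<sigma> * relabel \<sigma> G i j) = (if i = j then 0 else l)"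
    using relabel_combE[OF l] by blast
  then show "\<exists>c :: (nat \<Rightarrow> nat) \<Rightarrow> int. int m = (\<Sum>\<sigma> | \<sigma> permutes {1..n}. c \<sigma>) \<and>
      in_span_I_J n (\<lambda>i j. \<Sum>\<sigma> | \<sigma> permutes {1..n}. c \<sigma> * relabel \<sigma> G i j)"
    unfolding in_span_I_J_def by (intro exI[of _ c] conjI exI[of _ "- l"] exI[of _ l]) auto
qed

text \<open>Weighting the generator of vertex \<open>\<sigma> 1\<close> by \<open>c \<sigma>\<close>
  gives first coordinate \<open>m\<close>, second \<open>(n - 1) * l\<close> from the first row sum,
  and third \<open>l\<close> up to a multiple of the index.\<close>

lemma comb_imp_Lambda_star:
  assumes n: "n \<ge> 4" and G: "signed_multigraph n G" and f: "potential_vector n G f"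
    and comb: "relabel_comb n G m (\<lambda>i j. if i = j then 0 else l)"
  shows "of_int m *s mean_vector n G \<in> Lambda_star n G f"
proof -
  interpret module int_scale by (rule module_int_scale)
  let ?k = "primitivity_index n G"
  let ?P = "{\<sigma>. \<sigma> permutes {1..n}}"
  obtain e where e: "\<And>i j. i \<in> {1..n} \<Longrightarrow> j \<in> {1..n} \<Longrightarrow> i \<noteq> j \<Longrightarrow>
      of_int (G i j) = f i + f j + of_int ?k * of_int (e i j)"
    using potential_vectorE[OF f] by metis
  obtain c where c: "m = (\<Sum>\<sigma>\<in>?P. c \<sigma>)"
    and cl: "\<And>i j. i \<in> {1..n} \<Longrightarrow> j \<in> {1..n} \<Longrightarrow>
      (\<Sum>\<sigma>\<in>?P. c \<sigma> * relabel \<sigma> G i j) = (if i = j then 0 else l)"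
    using relabel_combE[OF comb] by blast
  have deg: "(\<Sum>\<sigma>\<in>?P. c \<sigma> * degree n G (\<sigma> p)) = (int n - 1) * l" if p: "p \<in> {1..n}" for p
  proof -
    have "(\<Sum>\<sigma>\<in>?P. c \<sigma> * degree n G (\<sigma> p)) = (\<Sum>\<sigma>\<in>?P. c \<sigma> * degree n (relabel \<sigma> G) p)"
      by (intro sum.cong) (simp_all add: degree_relabel)
    also have "\<dots> = (\<Sum>j\<in>{1..n}. \<Sum>\<sigma>\<in>?P. c \<sigma> * relabel \<sigma> G p j)"
      unfolding degree_def sum_distrib_left by (rule sum.swap)
    also have "\<dots> = (\<Sum>j\<in>{1..n}. if p = j then 0 else l)"
      using p by (intro sum.cong refl cl)
    also have "\<dots> = (\<Sum>j\<in>{1..n} - {p}. l)"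
      using p by (subst sum.remove[of _ p]) auto
    also have "\<dots> = (int n - 1) * l" using p by (simp add: of_nat_diff)
    finally show ?thesis .
  qed
  \<comment> \<open>Double counting: each relabeling has the same total degree, while the
    combination has \<open>n * (n - 1)\<close> off-diagonal entries \<open>l\<close>.\<close>
  have E: "of_int m * (2 * num_edges n G) = of_nat n * (of_nat n - 1) * of_int l"
  proof -
    have "m * (\<Sum>p\<in>{1..n}. degree n G p) = (\<Sum>\<sigma>\<in>?P. c \<sigma> * (\<Sum>p\<in>{1..n}. degree n G (\<sigma> p)))"
      unfolding c sum_distrib_right
      by (intro sum.cong refl) (simp add: sum.permute[unfolded o_def, symmetric])
    also have "\<dots> = (\<Sum>p\<in>{1..n}. \<Sum>\<sigma>\<in>?P. c \<sigma> * degree n G (\<sigma> p))"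
      unfolding sum_distrib_left by (rule sum.swap)
    also have "\<dots> = int n * (int n - 1) * l"
      by (subst sum.cong[OF refl deg]) simp_all
    finally have "rat_of_int (m * (\<Sum>p\<in>{1..n}. degree n G p)) = rat_of_int (int n * (int n - 1) * l)"
      by (rule arg_cong)
    then show ?thesis by (simp only: of_int_mult sum_degree) simp
  qed
  text \<open>Modulo \<open>k\<close>, the potential at a vertex is recovered as \<open>2 f\<^sub>1 = G\<^sub>1\<^sub>2 + G\<^sub>1\<^sub>3 - G\<^sub>2\<^sub>3\<close>.\<close>
  define u where "u = (\<Sum>\<sigma>\<in>?P. c \<sigma> * (e (\<sigma> 1) (\<sigma> 2) + e (\<sigma> 1) (\<sigma> 3) - e (\<sigma> 2) (\<sigma> 3)))"
  have pot: "(\<Sum>\<sigma>\<in>?P. of_int (c \<sigma>) * (2 * f (\<sigma> 1))) + of_int u * of_int ?k = of_int l"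
  proof -
    have "of_int (c \<sigma>) * (2 * f (\<sigma> 1)) + of_int (c \<sigma> * (e (\<sigma> 1) (\<sigma> 2) + e (\<sigma> 1) (\<sigma> 3) - e (\<sigma> 2) (\<sigma> 3))) * of_int ?k
        = rat_of_int (c \<sigma> * relabel \<sigma> G 1 2 + c \<sigma> * relabel \<sigma> G 1 3 - c \<sigma> * relabel \<sigma> G 2 3)"
      if \<sigma>: "\<sigma> \<in> ?P" for \<sigma>
    proof -
      have "\<sigma> 1 \<in> {1..n}" "\<sigma> 2 \<in> {1..n}" "\<sigma> 3 \<in> {1..n}"
        using \<sigma> n permutes_in_image[of \<sigma> "{1..n}"] by auto
      moreover have "\<sigma> 1 \<noteq> \<sigma> 2" "\<sigma> 1 \<noteq> \<sigma> 3" "\<sigma> 2 \<noteq> \<sigma> 3"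
        using \<sigma> permutes_inj[of \<sigma> "{1..n}"] by (auto simp: inj_eq)
      ultimately show ?thesis by (simp add: relabel_def e algebra_simps)
    qed
    then have "(\<Sum>\<sigma>\<in>?P. of_int (c \<sigma>) * (2 * f (\<sigma> 1))) + of_int u * of_int ?k =
      (\<Sum>\<sigma>\<in>?P. rat_of_int (c \<sigma> * relabel \<sigma> G 1 2 + c \<sigma> * relabel \<sigma> G 1 3 - c \<sigma> * relabel \<sigma> G 2 3))"
      unfolding u_def of_int_sum sum_distrib_right sum.distrib[symmetric] by (intro sum.cong refl)
    also have "\<dots> = rat_of_int ((\<Sum>\<sigma>\<in>?P. c \<sigma> * relabel \<sigma> G 1 2) + (\<Sum>\<sigma>\<in>?P. c \<sigma> * relabel \<sigma> G 1 3) -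
        (\<Sum>\<sigma>\<in>?P. c \<sigma> * relabel \<sigma> G 2 3))"
      by (simp only: of_int_sum[symmetric] sum.distrib sum_subtractf)
    also have "\<dots> = of_int l"
      using n by (subst (1 2 3) cl) auto
    finally show ?thesis .
  qed
  have nn: "of_nat n \<noteq> (0 :: rat)" "of_nat n - 1 \<noteq> (0 :: rat)"
    using n by auto
  have d1: "(\<Sum>\<sigma>\<in>?P. rat_of_int (c \<sigma>) * of_int (degree n G (\<sigma> 1))) = (of_nat n - 1) * of_int l"
    using arg_cong[OF deg[of 1], of rat_of_int] n by simp
  have "of_int m *s mean_vector n G =
      (\<Sum>\<sigma>\<in>?P. int_scale (c \<sigma>) (vector [1, of_int (degree n G (\<sigma> 1)), 2 * f (\<sigma> 1)])) +
      int_scale u (vector [0, 0, of_int ?k])"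
    using pot d1 E nn c by (simp add: vec_eq_iff forall_3 int_scale_def mean_vector_def)
  also have "\<dots> \<in> Lambda_star n G f"
    unfolding Lambda_star_def using n permutes_in_image[of _ "{1..n}" 1]
    by (intro span_add span_sum span_scale span_base) auto
  finally show ?thesis .
qed

text \<open>Dividing by the index leaves an integer matrix with zero row sums, to which the
  decomposition into alternating cycles applies.\<close>

lemma zero_row_sums_relabel_comb:
  assumes G: "signed_multigraph n G" and n: "n \<ge> 4"
    and sym: "\<And>i j. i \<in> {1..n} \<Longrightarrow> j \<in> {1..n} \<Longrightarrow> x i j = x j i"
    and diag: "\<And>i. i \<in> {1..n} \<Longrightarrow> x i i = 0"
    and row: "\<And>i. i \<in> {1..n} \<Longrightarrow> (\<Sum>j\<in>{1..n}. x i j) = 0"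
    and dvd: "\<And>i j. i \<in> {1..n} \<Longrightarrow> j \<in> {1..n} \<Longrightarrow> primitivity_index n G dvd x i j"
  shows "relabel_comb n G 0 x"
proof -
  let ?k = "primitivity_index n G"
  \<comment> \<open>Zero outside the range, as the induction principle requires for all indices. For
    index 0, divisibility makes \<open>x\<close> zero on the range and \<open>div\<close> returns
    0.\<close>
  define y where "y i j = (if i \<in> {1..n} \<and> j \<in> {1..n} then x i j div ?k else 0)" for i j
  have ky: "?k * y i j = x i j" if "i \<in> {1..n}" "j \<in> {1..n}" for i j
    using that dvd by (simp add: y_def)
  have "relabel_comb n G 0 (\<lambda>i j. ?k * y i j)"
  proof (rule zero_row_sums_induct[where P = "\<lambda>y. relabel_comb n G 0 (\<lambda>i j. ?k * y i j)" and m = n])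
    show "relabel_comb n G 0 (\<lambda>i j. ?k * 0)" by (simp add: relabel_comb_zero)
    show "relabel_comb n G 0 (\<lambda>i j. ?k * (M i j + N i j))"
      if "relabel_comb n G 0 (\<lambda>i j. ?k * M i j)" "relabel_comb n G 0 (\<lambda>i j. ?k * N i j)" for M N
      using relabel_comb_add[OF that] by (simp add: distrib_left)
    show "relabel_comb n G 0 (\<lambda>i j. ?k * (t * alt_cycle a b c d i j))"
      if "distinct [a, b, c, d]" "{a, b, c, d} \<subseteq> {1..n}" for a b c d t
      using relabel_comb_scale[OF relabel_comb_alt_cycle[OF G that n], of t] by (simp add: mult.left_commute)
    show "y i j = y j i" for i j by (simp add: y_def sym)
    show "y i i = 0" for i by (simp add: y_def diag)
    show "y i j = 0" if "i \<notin> {1..n}" for i j using that by (auto simp: y_def)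
    show "(\<Sum>j\<in>{1..n}. y i j) = 0" for i
    proof (cases "?k = 0 \<or> i \<notin> {1..n}")
      case True
      then show ?thesis by (intro sum.neutral) (auto simp: y_def)
    next
      case False
      then have "?k * (\<Sum>j\<in>{1..n}. y i j) = 0"
        using row[of i] ky[of i] unfolding sum_distrib_left by (metis (no_types, lifting) sum.cong)
      then show ?thesis using False by simp
    qed
  qed
  then show ?thesis by (rule relabel_comb_cong) (rule ky)
qed

text \<open>The membership coefficients become the first rows of a permutation combination
  \<open>T\<close>; its deviation \<open>x\<close> from \<open>l\<close> off the diagonal is then
  removed at coefficient sum 0.\<close>

lemma Lambda_star_imp_comb:
  assumes n: "n \<ge> 4" and G: "signed_multigraph n G" and f: "potential_vector n G f"
    and mem: "of_int m *s mean_vector n G \<in> Lambda_star n G f"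
  obtains l where "relabel_comb n G m (\<lambda>i j. if i = j then 0 else l)"
proof -
  let ?k = "primitivity_index n G" and ?F = "\<Sum>j\<in>{1..n}. f j"
  let ?P = "{\<sigma>. \<sigma> permutes {1..n}}"
  obtain e where e: "\<And>i j. i \<in> {1..n} \<Longrightarrow> j \<in> {1..n} \<Longrightarrow> i \<noteq> j \<Longrightarrow>
      of_int (G i j) = f i + f j + of_int ?k * of_int (e i j)"
    using potential_vectorE[OF f] by metis
  have int2f: "2 * f i \<in> \<int>" if "i \<in> {1..n}" for i
    using f that unfolding potential_vector_def by (metis Ints_mult Ints_numeral)
  obtain a t where at:
    "(of_int m *s mean_vector n G) $ 1 = (\<Sum>i\<in>{1..n}. rat_of_int (a i))"
    "(of_int m *s mean_vector n G) $ 2 = (\<Sum>i\<in>{1..n}. of_int (a i) * of_int (degree n G i))"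
    "(of_int m *s mean_vector n G) $ 3 =
      (\<Sum>i\<in>{1..n}. of_int (a i) * (2 * f i)) + of_int t * of_int ?k"
    using mem unfolding Lambda_star_iff by blast
  have a1: "of_int m = (\<Sum>i\<in>{1..n}. rat_of_int (a i))"
    and a2: "of_int m * (2 * num_edges n G / of_nat n) = (\<Sum>i\<in>{1..n}. of_int (a i) * of_int (degree n G i))"
    and a3: "of_int m * (2 * num_edges n G / (of_nat n * (of_nat n - 1))) =
      (\<Sum>i\<in>{1..n}. of_int (a i) * (2 * f i)) + of_int t * of_int ?k"
    using at by (simp_all add: mean_vector_def)
  \<comment> \<open>Whether the potentials are integral or half-integral, their doubles are
    integers. The third coordinate is thus an integer \<open>l\<close>, the intended off-diagonal
    value.\<close>
  have "(\<Sum>i\<in>{1..n}. of_int (a i) * (2 * f i)) + of_int t * of_int ?k \<in> \<int>"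
    by (intro Ints_add Ints_sum Ints_mult[OF Ints_of_int int2f] Ints_mult[OF Ints_of_int Ints_of_int])
  then obtain l where l: "(\<Sum>i\<in>{1..n}. of_int (a i) * (2 * f i)) + of_int t * of_int ?k = of_int l"
    by (rule Ints_cases)
  have nn: "of_nat n \<noteq> (0 :: rat)" "of_nat n - 1 \<noteq> (0 :: rat)"
    using n by auto
  have E: "of_int m * (2 * num_edges n G) = of_nat n * (of_nat n - 1) * of_int l"
    using a3 nn unfolding l by (simp add: field_simps)
  have Sd: "(\<Sum>i\<in>{1..n}. of_int (a i) * of_int (degree n G i)) = (of_nat n - 1) * rat_of_int l"
    using a2[symmetric] nn unfolding times_divide_eq_right E by simp
  have m: "m = (\<Sum>i\<in>{1..n}. a i)" using a1 by (metis of_int_eq_iff of_int_sum)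
  define A where "A = (\<Sum>i\<in>{1..n}. of_int (a i) * f i)"
  have A: "2 * A = of_int l - of_int t * of_int ?k"
    using l by (simp add: A_def sum_distrib_left mult.left_commute algebra_simps)
  define s where "s = (\<Sum>i\<in>{1..n}. a i * (\<Sum>j\<in>{1..n} - {i}. e i j))"
  \<comment> \<open>The second coordinate rewritten through the potentials; it serves to eliminate
    \<open>?F\<close> from the last row \<open>S n\<close>.\<close>
  have mF: "(of_nat n - 1) * of_int l = (of_nat n - 2) * A + of_int m * ?F + of_int ?k * of_int s"
  proof -
    have expand: "x * (N * y + F + K * z) = N * (x * y) + x * F + K * (x * z)" for x F N y K z :: rat
      by (simp add: algebra_simps)
    have "(of_nat n - 1) * of_int l = (\<Sum>i\<in>{1..n}. of_int (a i) *
        ((of_nat n - 2) * f i + ?F + of_int ?k * of_int (\<Sum>j\<in>{1..n} - {i}. e i j)))"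
      unfolding Sd[symmetric]
      by (intro sum.cong refl arg_cong2[where f = "(*)"] degree_potential[OF G _ e])
    also have "\<dots> = (of_nat n - 2) * A + of_int m * ?F + of_int ?k * of_int s"
      by (simp add: A_def m s_def expand sum.distrib flip: sum_distrib_left sum_distrib_right)
    finally show ?thesis .
  qed
  obtain c :: "(nat \<Rightarrow> nat) \<Rightarrow> int" where
    "\<forall>p\<in>{1..n}. \<forall>g :: nat \<Rightarrow> rat. (\<Sum>\<sigma>\<in>?P. of_int (c \<sigma>) * g (\<sigma> p)) =
      (if p < n then \<Sum>i\<in>{1..n}. of_int (a i) * g i
       else of_int m * (\<Sum>j\<in>{1..n}. g j) - (of_nat n - 1) * (\<Sum>i\<in>{1..n}. of_int (a i) * g i))"
    using constant_row_comb[of n a] unfolding m[symmetric] by (elim exE)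
  note c = this[rule_format]
  have cm: "(\<Sum>\<sigma>\<in>?P. c \<sigma>) = m"
  proof -
    have "rat_of_int (\<Sum>\<sigma>\<in>?P. c \<sigma>) = of_int m"
      using c[of 1 "\<lambda>_. 1"] n a1 by simp
    then show ?thesis by (simp only: of_int_eq_iff)
  qed
  define T where "T i j = (\<Sum>\<sigma>\<in>?P. c \<sigma> * relabel \<sigma> G i j)" for i j
  have T: "relabel_comb n G m T"
    unfolding relabel_comb_def T_def using cm by blast
  have G_sym: "relabel \<sigma> G i j = relabel \<sigma> G j i" "relabel \<sigma> G i i = 0"
    if "\<sigma> permutes {1..n}" "i \<in> {1..n}" "j \<in> {1..n}" for \<sigma> i j
    using G permutes_in_image[OF that(1)] that unfolding signed_multigraph_def relabel_def by blast+
  have T_sym: "T i j = T j i" if "i \<in> {1..n}" "j \<in> {1..n}" for i j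
    unfolding T_def using G_sym(1) that by (intro sum.cong) auto
  have T_diag: "T i i = 0" if "i \<in> {1..n}" for i
    unfolding T_def using G_sym(2) that by (intro sum.neutral) auto
  \<comment> \<open>For \<open>p < n\<close> this is \<open>Sd\<close>. For \<open>p = n\<close> the
    forced last row gives \<open>n * (n - 1) * l\<close> minus \<open>(n - 1) * (n - 1) * l\<close>,
    by \<open>E\<close>.\<close>
  have T_row: "(\<Sum>j\<in>{1..n}. T p j) = (int n - 1) * l" if p: "p \<in> {1..n}" for p
  proof -
    have "(\<Sum>j\<in>{1..n}. T p j) = (\<Sum>\<sigma>\<in>?P. c \<sigma> * degree n (relabel \<sigma> G) p)"
      unfolding degree_def sum_distrib_left T_def by (rule sum.swap)
    also have "\<dots> = (\<Sum>\<sigma>\<in>?P. c \<sigma> * degree n G (\<sigma> p))"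
      by (intro sum.cong) (simp_all add: degree_relabel)
    finally have "rat_of_int (\<Sum>j\<in>{1..n}. T p j) = (\<Sum>\<sigma>\<in>?P. of_int (c \<sigma>) * of_int (degree n G (\<sigma> p)))"
      by (simp only: of_int_sum of_int_mult)
    also have "\<dots> = (of_nat n - 1) * of_int l"
      unfolding c[OF p, of "\<lambda>i. of_int (degree n G i)"] Sd sum_degree[unfolded of_int_sum] E
      by (simp add: algebra_simps)
    also have "\<dots> = of_int ((int n - 1) * l)" by simp
    finally show ?thesis by (simp only: of_int_eq_iff)
  qed
  define S where "S p = (\<Sum>\<sigma>\<in>?P. of_int (c \<sigma>) * f (\<sigma> p))" for p
  have S: "S p = A" if "p \<in> {1..n}" "p < n" for p
    using c[OF that(1), of f] that(2) by (simp add: S_def A_def)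
  have S_last: "S n = of_int m * ?F - (of_nat n - 1) * A"
    using c[of n f] n by (simp add: S_def A_def)
  \<comment> \<open>Two indices below \<open>n\<close> give \<open>2 * A\<close>. At most one of
    them is \<open>n\<close>, and then the sum is \<open>A + S n\<close>, where \<open>mF\<close>
    again leaves only a multiple of \<open>2 * A\<close>; a lone \<open>A\<close> could be
    half-integral modulo the index.\<close>
  have half: "\<exists>r :: int. S p + S q = of_int l + of_int ?k * of_int r"
    if "p \<in> {1..n}" "q \<in> {1..n}" "p \<noteq> q" for p q
  proof (cases "p < n \<and> q < n")
    case True
    then show ?thesis using that A by (intro exI[of _ "- t"]) (simp add: S algebra_simps)
  next
    case False
    then have "S p + S q = A + S n"
      using that S[of p] S[of q] by (cases "p < n"; cases "q < n") auto
    also have "\<dots> = (of_nat n - 1) * of_int l - of_int ?k * of_int s - (of_nat n - 2) * (2 * A)"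
      using mF unfolding S_last by (simp add: algebra_simps)
    also have "\<dots> = of_int l + of_int ?k * of_int ((int n - 2) * t - s)"
      unfolding A by (simp add: algebra_simps)
    finally show ?thesis by blast
  qed
  define x where "x i j = T i j - (if i = j then 0 else l)" for i j
  have dvd: "?k dvd x i j" if ij: "i \<in> {1..n}" "j \<in> {1..n}" for i j
  proof (cases "i = j")
    case True
    then show ?thesis using ij T_diag by (simp add: x_def)
  next
    case False
    obtain r :: int where r: "S i + S j = of_int l + of_int ?k * of_int r"
      using half ij False by blast
    have "rat_of_int (T i j) = (\<Sum>\<sigma>\<in>?P. of_int (c \<sigma>) *
        (f (\<sigma> i) + f (\<sigma> j) + of_int ?k * of_int (e (\<sigma> i) (\<sigma> j))))"
      unfolding T_def of_int_sum of_int_mult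
    proof (intro sum.cong refl arg_cong2[where f = "(*)"])
      fix \<sigma> assume "\<sigma> \<in> ?P"
      then have \<sigma>: "\<sigma> permutes {1..n}" by simp
      show "rat_of_int (relabel \<sigma> G i j) = f (\<sigma> i) + f (\<sigma> j) + of_int ?k * of_int (e (\<sigma> i) (\<sigma> j))"
        unfolding relabel_def
        using e[of "\<sigma> i" "\<sigma> j"] ij False permutes_in_image[OF \<sigma>] inj_eq[OF permutes_inj[OF \<sigma>]] by blast
    qed
    also have "\<dots> = S i + S j + of_int ?k * of_int (\<Sum>\<sigma>\<in>?P. c \<sigma> * e (\<sigma> i) (\<sigma> j))"
      by (simp add: S_def distrib_left sum.distrib sum_distrib_left mult.left_commute)
    finally have "rat_of_int (T i j) = of_int (l + ?k * (r + (\<Sum>\<sigma>\<in>?P. c \<sigma> * e (\<sigma> i) (\<sigma> j))))"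
      using r by (simp add: distrib_left)
    then have "x i j = ?k * (r + (\<Sum>\<sigma>\<in>?P. c \<sigma> * e (\<sigma> i) (\<sigma> j)))"
      using False by (simp only: of_int_eq_iff x_def) simp
    then show ?thesis by simp
  qed
  have "relabel_comb n G 0 x"
  proof (rule zero_row_sums_relabel_comb[OF G n _ _ _ dvd])
    show "x i j = x j i" if "i \<in> {1..n}" "j \<in> {1..n}" for i j
      using T_sym[OF that] by (simp add: x_def)
    show "x i i = 0" if "i \<in> {1..n}" for i
      using T_diag[OF that] by (simp add: x_def)
    show "(\<Sum>j\<in>{1..n}. x i j) = 0" if "i \<in> {1..n}" for i
    proof -
      have "(\<Sum>j\<in>{1..n}. if i = j then 0 else l) = (\<Sum>j\<in>{1..n} - {i}. l)"
        using that by (subst sum.remove[of _ i]) auto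
      also have "\<dots> = (int n - 1) * l" using that by (simp add: of_nat_diff)
      finally show ?thesis unfolding x_def sum_subtractf T_row[OF that] by simp
    qed
  qed
  \<comment> \<open>Subtracting \<open>x\<close> from \<open>T\<close> leaves exactly
    \<open>l\<close> off the diagonal and keeps the coefficient sum \<open>m\<close>.\<close>
  from relabel_comb_diff[OF T this] show ?thesis
    by (intro that[of l]) (simp add: x_def)
qed

theorem theorem3p5:
  fixes n :: nat and G :: "nat \<Rightarrow> nat \<Rightarrow> int" and f :: "nat \<Rightarrow> rat"
  assumes "n \<ge> 4"
    and "signed_multigraph n G"
    and "potential_vector n G f"
  shows "(\<exists>b :: nat. 0 < b \<and> of_nat b *s mean_vector n G \<in> Lambda_star n G f) \<and>
    bal n G = (LEAST b :: nat. 0 < b \<and> of_nat b *s mean_vector n G \<in> Lambda_star n G f)"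
proof
  show "\<exists>b :: nat. 0 < b \<and> of_nat b *s mean_vector n G \<in> Lambda_star n G f"
    by (rule mean_vector_in_Lambda_star_exists[OF assms])
  \<comment> \<open>Both minima range over the same multipliers.\<close>
  have "(\<exists>l. relabel_comb n G (int b) (\<lambda>i j. if i = j then 0 else l)) \<longleftrightarrow>
      of_nat b *s mean_vector n G \<in> Lambda_star n G f" for b
    using comb_imp_Lambda_star[OF assms, of "int b"] Lambda_star_imp_comb[OF assms, of "int b"]
    by (metis of_int_of_nat_eq)
  then show "bal n G = (LEAST b :: nat. 0 < b \<and> of_nat b *s mean_vector n G \<in> Lambda_star n G f)"
    unfolding bal_def balanced_comb_iff[OF assms(2)] by simp
qed

end
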